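(* Let $f(x)=p^{\alpha}\frac{P_1(x)}{Q_1(x)}$ be a rational function over $\mathbb{Q}_p$, where $\alpha\in\mathbb{Z}$, $P_1(x)=a_mx^m+a_{m-1}x^{m-1}+\cdots+a_0$ and $Q_1(x)=b_nx^n+b_{n-1}x^{n-1}+\cdots+b_0$ are in $\mathbb{Q}_p[x]$ with $a_m,b_n\in\mathbb{Z}_p^{\times}$, and $Q_1$ has no root in $\mathbb{Q}_p$. If $f$ is an invertible local isometry on $\mathbb{Q}_p$, then $\alpha=0$ and $m=n+1$.
   Context: $|\cdot|$ is the $p$-adic absolute value and $B_r(a)=\{x\in\mathbb{Q}_p:|x-a|\le r\}$. $f:\mathbb{Q}_p\to\mathbb{Q}_p$ is a local isometry if for every $a\in\mathbb{Q}_p$ there is $r>0$ with $|f(x)-f(y)|=|x-y|$ for all $x,y\in B_r(a)$; invertible means bijective. *)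

theory Defs
  imports
    "HOL-Analysis.Elementary_Metric_Spaces"
    "HOL-Computational_Algebra.Polynomial"
    "Berlekamp_Zassenhaus.Finite_Field"
begin

section \<open>The p-adic absolute value on the rationals\<close>

text \<open>
  With \<open>q = a / b\<close> in lowest terms this is \<open>p\<close> to the power \<open>v\<^sub>p(b) - v\<^sub>p(a)\<close>.
\<close>

definition padic_abs :: "nat \<Rightarrow> rat \<Rightarrow> real" where
  "padic_abs p q = (if q = 0 then 0 else
     (case quotient_of q of (a, b) \<Rightarrow>
        real p ^ multiplicity (int p) b / real p ^ multiplicity (int p) a))"

context
  fixes p :: nat
  assumes p: "prime p"
begin

lemma padic_abs_fraction:
  assumes "a \<noteq> 0" "b \<noteq> 0"
  shows "padic_abs p (of_int a / of_int b) =
    real p ^ multiplicity (int p) b / real p ^ multiplicity (int p) a"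
proof -
  obtain c d where cd: "quotient_of (of_int a / of_int b) = (c, d)"
    by (cases "quotient_of (of_int a / of_int b)") auto
  have d: "d > 0" using quotient_of_denom_pos[OF cd] .
  have eq: "(of_int a / of_int b :: rat) = of_int c / of_int d"
    using quotient_of_div[OF cd] .
  have c: "c \<noteq> 0" using eq assms d by auto
  have "(of_int (a * d) :: rat) = of_int (c * b)"
    using eq assms d by (simp add: field_simps)
  then have e: "a * d = c * b" by (simp only: of_int_eq_iff)
  have pe: "prime_elem (int p)" using p by auto
  have "multiplicity (int p) a + multiplicity (int p) d =
        multiplicity (int p) c + multiplicity (int p) b"
    using e assms c d pe by (metis order_less_irrefl prime_elem_multiplicity_mult_distrib)
  then have "real p ^ multiplicity (int p) a * real p ^ multiplicity (int p) d =
        real p ^ multiplicity (int p) c * real p ^ multiplicity (int p) b"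
    by (metis power_add)
  moreover have "real p > 0" using p prime_gt_0_nat by auto
  ultimately show ?thesis
    using cd assms by (simp add: padic_abs_def field_simps)
qed

lemma padic_abs_0 [simp]: "padic_abs p 0 = 0"
  by (simp add: padic_abs_def)

lemma padic_abs_1 [simp]: "padic_abs p 1 = 1"
  by (simp add: padic_abs_def)

lemma padic_abs_pos: "q \<noteq> 0 \<Longrightarrow> padic_abs p q > 0"
  using p prime_gt_0_nat by (auto simp: padic_abs_def split: prod.splits)

lemma padic_abs_nonneg [simp]: "padic_abs p q \<ge> 0"
  using padic_abs_pos[of q] by (cases "q = 0") auto

lemma padic_abs_eq_0_iff [simp]: "padic_abs p q = 0 \<longleftrightarrow> q = 0"
  using padic_abs_pos[of q] by (cases "q = 0") auto

lemma rat_fraction_cases: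
  obtains a b where "b > 0" "(q :: rat) = of_int a / of_int b"
  by (metis quotient_of_denom_pos quotient_of_div surj_pair)

lemma padic_abs_mult: "padic_abs p (q * r) = padic_abs p q * padic_abs p r"
proof (cases "q = 0 \<or> r = 0")
  case False
  obtain a b where ab: "b > 0" "q = of_int a / of_int b" by (rule rat_fraction_cases)
  obtain c d where cd: "d > 0" "r = of_int c / of_int d" by (rule rat_fraction_cases)
  have nz: "a \<noteq> 0" "c \<noteq> 0" "b \<noteq> 0" "d \<noteq> 0" using False ab cd by auto
  have pe: "prime_elem (int p)" using p by auto
  have "q * r = of_int (a * c) / of_int (b * d)" using ab cd by simp
  moreover have "multiplicity (int p) (a * c) = multiplicity (int p) a + multiplicity (int p) c"
    "multiplicity (int p) (b * d) = multiplicity (int p) b + multiplicity (int p) d"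
    using nz pe by (simp_all add: prime_elem_multiplicity_mult_distrib)
  ultimately show ?thesis
    using nz padic_abs_fraction[of "a * c" "b * d"] padic_abs_fraction[of a b]
      padic_abs_fraction[of c d] ab cd by (simp add: power_add)
qed auto

lemma padic_abs_minus [simp]: "padic_abs p (- q) = padic_abs p q"
proof -
  have "padic_abs p (- 1) * padic_abs p (- 1) = 1"
    by (simp flip: padic_abs_mult)
  then have "padic_abs p (- 1) = 1"
    using padic_abs_nonneg[of "- 1"] by (simp add: square_eq_1_iff)
  then show ?thesis using padic_abs_mult[of "- 1" q] by simp
qed

lemma padic_abs_minus_commute: "padic_abs p (q - r) = padic_abs p (r - q)"
  using padic_abs_minus[of "q - r"] by simp

lemma padic_abs_inverse: "padic_abs p (inverse q) = inverse (padic_abs p q)"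
proof (cases "q = 0")
  case False
  then have "padic_abs p (inverse q) * padic_abs p q = 1" by (simp flip: padic_abs_mult)
  then show ?thesis by (metis inverse_unique mult.commute)
qed simp

lemma padic_abs_add_le_max: "padic_abs p (q + r) \<le> max (padic_abs p q) (padic_abs p r)"
proof (cases "q = 0 \<or> r = 0 \<or> q + r = 0")
  case False
  obtain a b where ab: "b > 0" "q = of_int a / of_int b" by (rule rat_fraction_cases)
  obtain c d where cd: "d > 0" "r = of_int c / of_int d" by (rule rat_fraction_cases)
  define x y z where "x = a * d" and "y = c * b" and "z = b * d"
  have q: "q = of_int x / of_int z" and r: "r = of_int y / of_int z" and z: "z \<noteq> 0"
    using ab cd by (auto simp: x_def y_def z_def)
  have qr: "q + r = of_int (x + y) / of_int z" by (simp add: q r add_divide_distrib)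
  have nz: "x \<noteq> 0" "y \<noteq> 0" "x + y \<noteq> 0" using False q r qr by auto
  have p1: "real p > 1" using p prime_gt_1_nat by auto
  have nu: "\<not> is_unit (int p)" using p prime_elem_not_unit[of "int p"] by auto
  let ?v = "multiplicity (int p)"
  have "int p ^ min (?v x) (?v y) dvd x + y"
    by (intro dvd_add) (auto intro: multiplicity_dvd')
  then have "min (?v x) (?v y) \<le> ?v (x + y)"
    using nz nu by (intro multiplicity_geI) auto
  then have "?v x \<le> ?v (x + y) \<or> ?v y \<le> ?v (x + y)" by auto
  then have "real p ^ ?v z / real p ^ ?v (x + y) \<le> real p ^ ?v z / real p ^ ?v x \<or>
    real p ^ ?v z / real p ^ ?v (x + y) \<le> real p ^ ?v z / real p ^ ?v y"
    using p1 by (auto intro!: divide_left_mono power_increasing)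
  then show ?thesis
    using nz z unfolding qr unfolding q r by (auto simp: padic_abs_fraction simp del: of_int_add)
qed (auto simp: le_max_iff_disj)

lemma padic_abs_triangle: "padic_abs p (q + r) \<le> padic_abs p q + padic_abs p r"
  using padic_abs_add_le_max[of q r] padic_abs_nonneg[of q] padic_abs_nonneg[of r] by linarith

lemma padic_abs_diff_le: "\<bar>padic_abs p q - padic_abs p r\<bar> \<le> padic_abs p (q - r)"
  using padic_abs_triangle[of "q - r" r] padic_abs_triangle[of "r - q" q]
    padic_abs_minus_commute[of q r] by simp

end


section \<open>Cauchy sequences of rationals for the p-adic absolute value\<close>

definition padic_vanishes :: "nat \<Rightarrow> (nat \<Rightarrow> rat) \<Rightarrow> bool" where
  "padic_vanishes p X \<longleftrightarrow> (\<lambda>n. padic_abs p (X n)) \<longlonglongrightarrow> 0"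

definition padic_cauchy :: "nat \<Rightarrow> (nat \<Rightarrow> rat) \<Rightarrow> bool" where
  "padic_cauchy p X \<longleftrightarrow>
     (\<forall>e>0. \<exists>N. \<forall>m\<ge>N. \<forall>n\<ge>N. padic_abs p (X m - X n) < e)"

definition padic_rel :: "nat \<Rightarrow> (nat \<Rightarrow> rat) \<Rightarrow> (nat \<Rightarrow> rat) \<Rightarrow> bool" where
  "padic_rel p X Y \<longleftrightarrow>
     padic_cauchy p X \<and> padic_cauchy p Y \<and> padic_vanishes p (\<lambda>n. X n - Y n)"

context
  fixes p :: nat
  assumes p: "prime p"
begin

lemma padic_vanishes_0 [simp]: "padic_vanishes p (\<lambda>n. 0)"
  by (simp add: padic_vanishes_def p)

lemma padic_vanishes_le:
  assumes "padic_vanishes p X" "\<And>n. n \<ge> N \<Longrightarrow> padic_abs p (Y n) \<le> C * padic_abs p (X n)"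
  shows "padic_vanishes p Y"
proof -
  have "(\<lambda>n. C * padic_abs p (X n)) \<longlonglongrightarrow> C * 0"
    using assms(1) unfolding padic_vanishes_def by (rule tendsto_mult_left)
  then have "(\<lambda>n. C * padic_abs p (X n)) \<longlonglongrightarrow> 0" by simp
  then show ?thesis
    unfolding padic_vanishes_def
    by (rule tendsto_sandwich[OF _ _ tendsto_const, rotated 2])
      (auto intro!: always_eventually eventually_sequentiallyI[of N] assms(2) simp: p)
qed

lemma padic_vanishes_minus: "padic_vanishes p (\<lambda>n. - X n) \<longleftrightarrow> padic_vanishes p X"
  by (simp add: padic_vanishes_def p)

lemma padic_vanishes_add:
  assumes "padic_vanishes p X" "padic_vanishes p Y"
  shows "padic_vanishes p (\<lambda>n. X n + Y n)"
proof -
  have "(\<lambda>n. padic_abs p (X n) + padic_abs p (Y n)) \<longlonglongrightarrow> 0 + 0"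
    using assms unfolding padic_vanishes_def by (rule tendsto_add)
  then have "(\<lambda>n. padic_abs p (X n) + padic_abs p (Y n)) \<longlonglongrightarrow> 0" by simp
  then show ?thesis
    unfolding padic_vanishes_def
    by (rule tendsto_sandwich[OF _ _ tendsto_const, rotated 2])
      (auto intro!: always_eventually padic_abs_triangle simp: p)
qed

lemma padic_cauchyD:
  "padic_cauchy p X \<Longrightarrow> e > 0 \<Longrightarrow> \<exists>N. \<forall>m\<ge>N. \<forall>n\<ge>N. padic_abs p (X m - X n) < e"
  by (simp add: padic_cauchy_def)

lemma padic_cauchy_const [simp]: "padic_cauchy p (\<lambda>n. c)"
  by (simp add: padic_cauchy_def p)

lemma padic_cauchy_minus: "padic_cauchy p X \<Longrightarrow> padic_cauchy p (\<lambda>n. - X n)"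
  unfolding padic_cauchy_def by (simp add: padic_abs_minus_commute[OF p])

lemma padic_cauchy_add:
  assumes "padic_cauchy p X" "padic_cauchy p Y"
  shows "padic_cauchy p (\<lambda>n. X n + Y n)"
  unfolding padic_cauchy_def
proof (intro allI impI)
  fix e :: real assume e: "e > 0"
  obtain M where M: "\<forall>m\<ge>M. \<forall>n\<ge>M. padic_abs p (X m - X n) < e"
    using padic_cauchyD[OF assms(1) e] by blast
  obtain N where N: "\<forall>m\<ge>N. \<forall>n\<ge>N. padic_abs p (Y m - Y n) < e"
    using padic_cauchyD[OF assms(2) e] by blast
  show "\<exists>N. \<forall>m\<ge>N. \<forall>n\<ge>N. padic_abs p (X m + Y m - (X n + Y n)) < e"
  proof (intro exI allI impI)
    fix m n assume "max M N \<le> m" "max M N \<le> n"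
    then have "padic_abs p (X m - X n) < e" "padic_abs p (Y m - Y n) < e" using M N by auto
    moreover have "X m + Y m - (X n + Y n) = (X m - X n) + (Y m - Y n)" by simp
    ultimately show "padic_abs p (X m + Y m - (X n + Y n)) < e"
      using padic_abs_add_le_max[OF p, of "X m - X n" "Y m - Y n"]
      by (metis max_less_iff_conj order_le_less_trans)
  qed
qed

lemma padic_cauchy_bounded:
  assumes "padic_cauchy p X"
  obtains B where "B > 0" "\<And>n. padic_abs p (X n) \<le> B"
proof -
  obtain N where N: "\<forall>m\<ge>N. \<forall>n\<ge>N. padic_abs p (X m - X n) < 1"
    using padic_cauchyD[OF assms, of 1] by auto
  define B where "B = 1 + (\<Sum>k\<le>N. padic_abs p (X k))"
  have mem: "padic_abs p (X k) \<le> (\<Sum>k\<le>N. padic_abs p (X k))" if "k \<le> N" for k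
    using that by (intro member_le_sum) (auto simp: p)
  have "padic_abs p (X n) \<le> B" for n
  proof (cases "n \<le> N")
    case True
    then show ?thesis using mem[of n] by (simp add: B_def)
  next
    case False
    then have "padic_abs p (X n - X N) < 1" using N by auto
    then show ?thesis
      using padic_abs_triangle[OF p, of "X n - X N" "X N"] mem[of N] by (simp add: B_def)
  qed
  moreover have "B > 0" by (auto simp: B_def p intro!: add_pos_nonneg sum_nonneg)
  ultimately show ?thesis using that by blast
qed

lemma padic_cauchy_mult:
  assumes "padic_cauchy p X" "padic_cauchy p Y"
  shows "padic_cauchy p (\<lambda>n. X n * Y n)"
  unfolding padic_cauchy_def
proof (intro allI impI)
  fix e :: real assume e: "e > 0"
  obtain A where A: "A > 0" "\<And>n. padic_abs p (X n) \<le> A"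
    using padic_cauchy_bounded[OF assms(1)] by blast
  obtain B where B: "B > 0" "\<And>n. padic_abs p (Y n) \<le> B"
    using padic_cauchy_bounded[OF assms(2)] by blast
  obtain M where M: "\<forall>m\<ge>M. \<forall>n\<ge>M. padic_abs p (X m - X n) < e / B"
    using padic_cauchyD[OF assms(1), of "e / B"] e B by auto
  obtain N where N: "\<forall>m\<ge>N. \<forall>n\<ge>N. padic_abs p (Y m - Y n) < e / A"
    using padic_cauchyD[OF assms(2), of "e / A"] e A by auto
  show "\<exists>N. \<forall>m\<ge>N. \<forall>n\<ge>N. padic_abs p (X m * Y m - X n * Y n) < e"
  proof (intro exI allI impI)
    fix m n assume "max M N \<le> m" "max M N \<le> n"
    then have 1: "padic_abs p (X m - X n) < e / B" and 2: "padic_abs p (Y m - Y n) < e / A"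
      using M N by auto
    have "padic_abs p ((X m - X n) * Y m) \<le> padic_abs p (X m - X n) * B"
      using B p by (simp add: padic_abs_mult mult_left_mono)
    also have "\<dots> < e" using 1 B by (simp add: pos_less_divide_eq)
    finally have 3: "padic_abs p ((X m - X n) * Y m) < e" .
    have "padic_abs p (X n * (Y m - Y n)) \<le> A * padic_abs p (Y m - Y n)"
      using A p by (simp add: padic_abs_mult mult_right_mono)
    also have "\<dots> < e" using 2 A by (simp add: pos_less_divide_eq mult.commute)
    finally have 4: "padic_abs p (X n * (Y m - Y n)) < e" .
    have "X m * Y m - X n * Y n = (X m - X n) * Y m + X n * (Y m - Y n)"
      by (simp add: algebra_simps)
    then show "padic_abs p (X m * Y m - X n * Y n) < e"
      using 3 4 padic_abs_add_le_max[OF p, of "(X m - X n) * Y m" "X n * (Y m - Y n)"] by simp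
  qed
qed

lemma padic_vanishes_mult_bounded:
  assumes "padic_cauchy p X" "padic_vanishes p Y"
  shows "padic_vanishes p (\<lambda>n. X n * Y n)"
proof -
  obtain A where A: "A > 0" "\<And>n. padic_abs p (X n) \<le> A"
    using padic_cauchy_bounded[OF assms(1)] by blast
  show ?thesis
    by (rule padic_vanishes_le[OF assms(2), of 0 _ A])
      (use A p in \<open>simp add: padic_abs_mult mult_right_mono\<close>)
qed

lemma padic_cauchy_not_vanishes:
  assumes "padic_cauchy p X" "\<not> padic_vanishes p X"
  obtains b N where "b > 0" "\<And>n. n \<ge> N \<Longrightarrow> padic_abs p (X n) \<ge> b"
proof -
  obtain e where e: "e > 0" "\<And>N. \<exists>n\<ge>N. padic_abs p (X n) \<ge> e"
    using assms(2) p unfolding padic_vanishes_def LIMSEQ_def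
    by (auto simp: dist_real_def not_less)
  obtain N where N: "\<forall>m\<ge>N. \<forall>n\<ge>N. padic_abs p (X m - X n) < e / 2"
    using padic_cauchyD[OF assms(1), of "e / 2"] e by auto
  obtain k where k: "k \<ge> N" "padic_abs p (X k) \<ge> e" using e(2) by blast
  have "padic_abs p (X n) \<ge> e / 2" if "n \<ge> N" for n
  proof -
    have "padic_abs p (X k - X n) < e / 2" using N k that by blast
    then show ?thesis using padic_abs_triangle[OF p, of "X k - X n" "X n"] k by simp
  qed
  then show ?thesis using that[of "e / 2" N] e by auto
qed

lemma padic_inverse_diff:
  assumes "padic_abs p x \<ge> b" "padic_abs p y \<ge> b" "b > 0"
  shows "padic_abs p (inverse x - inverse y) \<le> padic_abs p (x - y) / b\<^sup>2"
proof -
  have nz: "x \<noteq> 0" "y \<noteq> 0" using assms p by auto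
  have "inverse x - inverse y = (y - x) * (inverse x * inverse y)"
    using nz by (simp add: field_simps)
  then have "padic_abs p (inverse x - inverse y) =
      padic_abs p (x - y) * inverse (padic_abs p x * padic_abs p y)"
    using p by (simp add: padic_abs_mult padic_abs_inverse padic_abs_minus_commute)
  also have "\<dots> \<le> padic_abs p (x - y) * inverse (b * b)"
    using assms p by (intro mult_left_mono le_imp_inverse_le mult_mono) auto
  finally show ?thesis by (simp add: power2_eq_square divide_inverse)
qed

lemma padic_cauchy_inverse:
  assumes "padic_cauchy p X" "\<not> padic_vanishes p X"
  shows "padic_cauchy p (\<lambda>n. inverse (X n))"
  unfolding padic_cauchy_def
proof (intro allI impI)
  fix e :: real assume e: "e > 0"
  obtain b M where b: "b > 0" "\<And>n. n \<ge> M \<Longrightarrow> padic_abs p (X n) \<ge> b"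
    using padic_cauchy_not_vanishes[OF assms] by blast
  obtain N where N: "\<forall>m\<ge>N. \<forall>n\<ge>N. padic_abs p (X m - X n) < e * b\<^sup>2"
    using padic_cauchyD[OF assms(1), of "e * b\<^sup>2"] e b by auto
  show "\<exists>N. \<forall>m\<ge>N. \<forall>n\<ge>N. padic_abs p (inverse (X m) - inverse (X n)) < e"
  proof (intro exI allI impI)
    fix m n assume "max M N \<le> m" "max M N \<le> n"
    then have "padic_abs p (inverse (X m) - inverse (X n)) \<le> padic_abs p (X m - X n) / b\<^sup>2"
      and "padic_abs p (X m - X n) < e * b\<^sup>2"
      using b N by (auto intro!: padic_inverse_diff)
    then show "padic_abs p (inverse (X m) - inverse (X n)) < e"
      using b by (smt (verit) pos_divide_less_eq zero_less_power)
  qed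
qed

lemma padic_vanishes_diff_inverse:
  assumes "padic_cauchy p X" "\<not> padic_vanishes p X" "padic_cauchy p Y" "\<not> padic_vanishes p Y"
    and "padic_vanishes p (\<lambda>n. X n - Y n)"
  shows "padic_vanishes p (\<lambda>n. inverse (X n) - inverse (Y n))"
proof -
  obtain a M where a: "a > 0" "\<And>n. n \<ge> M \<Longrightarrow> padic_abs p (X n) \<ge> a"
    using padic_cauchy_not_vanishes[OF assms(1,2)] by blast
  obtain b N where b: "b > 0" "\<And>n. n \<ge> N \<Longrightarrow> padic_abs p (Y n) \<ge> b"
    using padic_cauchy_not_vanishes[OF assms(3,4)] by blast
  show ?thesis
  proof (rule padic_vanishes_le[OF assms(5)])
    fix n assume "max M N \<le> n"
    then have "padic_abs p (X n) \<ge> min a b" "padic_abs p (Y n) \<ge> min a b"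
      using a(2)[of n] b(2)[of n] by auto
    then have "padic_abs p (inverse (X n) - inverse (Y n)) \<le> padic_abs p (X n - Y n) / (min a b)\<^sup>2"
      using a b by (intro padic_inverse_diff) auto
    then show "padic_abs p (inverse (X n) - inverse (Y n)) \<le>
        1 / (min a b)\<^sup>2 * padic_abs p (X n - Y n)" by simp
  qed
qed

lemma padic_vanishes_diff_commute:
  "padic_vanishes p (\<lambda>n. X n - Y n) \<longleftrightarrow> padic_vanishes p (\<lambda>n. Y n - X n)"
  using padic_vanishes_minus[of "\<lambda>n. X n - Y n"] by simp

lemma padic_vanishes_cong:
  assumes "padic_vanishes p (\<lambda>n. X n - Y n)"
  shows "padic_vanishes p X \<longleftrightarrow> padic_vanishes p Y"
  using padic_vanishes_add[OF assms, of Y]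
    padic_vanishes_add[OF assms[unfolded padic_vanishes_diff_commute[of X]], of X] by auto

lemma padic_rel_refl: "padic_cauchy p X \<Longrightarrow> padic_rel p X X"
  by (simp add: padic_rel_def)

lemma part_equivp_padic_rel: "part_equivp (padic_rel p)"
proof (rule part_equivpI)
  show "\<exists>X. padic_rel p X X" using padic_rel_refl[OF padic_cauchy_const] by blast
  show "symp (padic_rel p)"
    unfolding symp_def padic_rel_def using padic_vanishes_diff_commute by blast
  show "transp (padic_rel p)"
  proof (rule transpI)
    fix X Y Z assume "padic_rel p X Y" "padic_rel p Y Z"
    then show "padic_rel p X Z"
      using padic_vanishes_add[of "\<lambda>n. X n - Y n" "\<lambda>n. Y n - Z n"] by (auto simp: padic_rel_def)
  qed
qed

lemma padic_abs_convergent: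
  assumes "padic_cauchy p X"
  shows "convergent (\<lambda>n. padic_abs p (X n))"
proof (rule real_Cauchy_convergent, rule metric_CauchyI)
  fix e :: real assume "e > 0"
  then obtain N where N: "\<forall>m\<ge>N. \<forall>n\<ge>N. padic_abs p (X m - X n) < e"
    using padic_cauchyD[OF assms] by blast
  then show "\<exists>N. \<forall>m\<ge>N. \<forall>n\<ge>N. dist (padic_abs p (X m)) (padic_abs p (X n)) < e"
    using padic_abs_diff_le[OF p] by (metis dist_real_def order_le_less_trans)
qed

lemma padic_abs_lim_cong:
  assumes "padic_rel p X Y"
  shows "lim (\<lambda>n. padic_abs p (X n)) = lim (\<lambda>n. padic_abs p (Y n))"
proof -
  have v: "(\<lambda>n. padic_abs p (X n - Y n)) \<longlonglongrightarrow> 0"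
    using assms by (simp add: padic_rel_def padic_vanishes_def)
  have "(\<lambda>n. padic_abs p (X n) - padic_abs p (Y n)) \<longlonglongrightarrow> 0"
    by (rule metric_tendsto_imp_tendsto[OF v]) (simp add: padic_abs_diff_le p dist_real_def)
  moreover have "(\<lambda>n. padic_abs p (Y n)) \<longlonglongrightarrow> lim (\<lambda>n. padic_abs p (Y n))"
    using assms padic_abs_convergent by (simp add: padic_rel_def convergent_LIMSEQ_iff)
  ultimately have "(\<lambda>n. padic_abs p (X n)) \<longlonglongrightarrow> lim (\<lambda>n. padic_abs p (Y n))"
    using tendsto_add by fastforce
  then show ?thesis by (rule limI)
qed

end


section \<open>The field of p-adic numbers\<close>

text \<open>
  The prime is carried by the type: \<open>'p padic\<close> is the field of p-adic numbers for \<open>p = CARD('p)\<close>,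
  and the sort \<open>prime_card\<close> says exactly that \<open>CARD('p)\<close> is prime.
\<close>

lemma prime_CARD: "prime CARD('p::prime_card)"
  by (rule prime_card)

text \<open>
  A point is a class of p-adic Cauchy sequences of rationals, two sequences being identified when
  their difference tends to zero.  The phantom type only attaches \<open>'p\<close> to the sequences.
\<close>

definition padic_eq ::
  "('p::prime_card, nat \<Rightarrow> rat) phantom \<Rightarrow> ('p, nat \<Rightarrow> rat) phantom \<Rightarrow> bool" where
  "padic_eq X Y \<longleftrightarrow> padic_rel CARD('p) (of_phantom X) (of_phantom Y)"

lemma part_equivp_padic_eq: "part_equivp (padic_eq :: ('p::prime_card, nat \<Rightarrow> rat) phantom \<Rightarrow> _)"
proof (rule part_equivpI)
  have P: "part_equivp (padic_rel CARD('p))" by (rule part_equivp_padic_rel[OF prime_CARD])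
  show "\<exists>X. padic_eq X (X :: ('p, nat \<Rightarrow> rat) phantom)"
    by (rule exI[of _ "phantom (\<lambda>n. 0)"])
      (simp add: padic_eq_def padic_rel_refl[OF prime_CARD] padic_cauchy_const[OF prime_CARD])
  show "symp (padic_eq :: ('p, nat \<Rightarrow> rat) phantom \<Rightarrow> _)"
    using part_equivp_symp[OF P] by (auto intro!: sympI simp: padic_eq_def)
  show "transp (padic_eq :: ('p, nat \<Rightarrow> rat) phantom \<Rightarrow> _)"
    using part_equivp_transp[OF P] by (auto intro!: transpI simp: padic_eq_def)
qed

quotient_type 'p padic = "('p::prime_card, nat \<Rightarrow> rat) phantom" / partial: padic_eq
  by (rule part_equivp_padic_eq)

instantiation padic :: (prime_card) field
begin

lift_definition zero_padic :: "'a padic" is "phantom (\<lambda>n. 0)"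
  by (simp add: padic_eq_def padic_rel_refl[OF prime_CARD] padic_cauchy_const[OF prime_CARD])

lift_definition one_padic :: "'a padic" is "phantom (\<lambda>n. 1)"
  by (simp add: padic_eq_def padic_rel_refl[OF prime_CARD] padic_cauchy_const[OF prime_CARD])

lift_definition plus_padic :: "'a padic \<Rightarrow> 'a padic \<Rightarrow> 'a padic"
  is "\<lambda>X Y. phantom (\<lambda>n. of_phantom X n + of_phantom Y n)"
  unfolding padic_eq_def padic_rel_def phantom.sel add_diff_add
  by (simp add: padic_cauchy_add[OF prime_CARD] padic_vanishes_add[OF prime_CARD])

lift_definition uminus_padic :: "'a padic \<Rightarrow> 'a padic"
  is "\<lambda>X. phantom (\<lambda>n. - of_phantom X n)"
  unfolding padic_eq_def padic_rel_def phantom.sel minus_diff_minus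
  by (simp add: padic_cauchy_minus[OF prime_CARD] padic_vanishes_minus[OF prime_CARD]
      del: minus_diff_eq)

lift_definition times_padic :: "'a padic \<Rightarrow> 'a padic \<Rightarrow> 'a padic"
  is "\<lambda>X Y. phantom (\<lambda>n. of_phantom X n * of_phantom Y n)"
proof -
  fix X X' Y Y' :: "('a, nat \<Rightarrow> rat) phantom"
  assume *: "padic_eq X X'" "padic_eq Y Y'"
  have "padic_vanishes CARD('a) (\<lambda>n. of_phantom X n * (of_phantom Y n - of_phantom Y' n) +
      of_phantom Y' n * (of_phantom X n - of_phantom X' n))"
    using * unfolding padic_eq_def padic_rel_def
    by (intro padic_vanishes_add[OF prime_CARD] padic_vanishes_mult_bounded[OF prime_CARD]) auto
  then show "padic_eq (phantom (\<lambda>n. of_phantom X n * of_phantom Y n) :: ('a, nat \<Rightarrow> rat) phantom)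
      (phantom (\<lambda>n. of_phantom X' n * of_phantom Y' n))"
    using * unfolding padic_eq_def padic_rel_def
    by (simp add: padic_cauchy_mult[OF prime_CARD] algebra_simps)
qed

lift_definition inverse_padic :: "'a padic \<Rightarrow> 'a padic"
  is "\<lambda>X. if padic_vanishes CARD('a) (of_phantom X) then phantom (\<lambda>n. 0)
        else phantom (\<lambda>n. inverse (of_phantom X n))"
proof -
  fix X Y :: "('a, nat \<Rightarrow> rat) phantom"
  assume *: "padic_eq X Y"
  then have "padic_vanishes CARD('a) (of_phantom X) \<longleftrightarrow> padic_vanishes CARD('a) (of_phantom Y)"
    unfolding padic_eq_def padic_rel_def by (intro padic_vanishes_cong[OF prime_CARD]) auto
  then show "?thesis X Y"
    using * unfolding padic_eq_def padic_rel_def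
    by (auto simp: padic_cauchy_const[OF prime_CARD] padic_vanishes_0[OF prime_CARD]
        padic_cauchy_inverse[OF prime_CARD] padic_vanishes_diff_inverse[OF prime_CARD])
qed

definition minus_padic :: "'a padic \<Rightarrow> 'a padic \<Rightarrow> 'a padic" where
  "minus_padic x y = x + - y"

definition divide_padic :: "'a padic \<Rightarrow> 'a padic \<Rightarrow> 'a padic" where
  "divide_padic x y = x * inverse y"

instance
proof
  note [simp] = padic_eq_def padic_rel_def padic_vanishes_0[OF prime_CARD]
    padic_cauchy_const[OF prime_CARD] padic_cauchy_add[OF prime_CARD]
    padic_cauchy_mult[OF prime_CARD] padic_cauchy_minus[OF prime_CARD]
  fix a b c :: "'a padic"
  show "a + b = b + a" by transfer (simp add: add.commute)
  show "(a + b) + c = a + (b + c)" by transfer (simp add: add.assoc)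
  show "0 + a = a" by transfer simp
  show "- a + a = 0" by transfer simp
  show "a - b = a + - b" by (rule minus_padic_def)
  show "(a * b) * c = a * (b * c)" by transfer (simp add: mult.assoc)
  show "a * b = b * a" by transfer (simp add: mult.commute)
  show "1 * a = a" by transfer simp
  show "(a + b) * c = a * c + b * c" by transfer (simp add: distrib_right)
  show "(0 :: 'a padic) \<noteq> 1"
    by transfer (simp add: padic_vanishes_def padic_abs_minus[OF prime_CARD]
        padic_abs_1[OF prime_CARD] LIMSEQ_const_iff)
  have "padic_vanishes CARD('a) (\<lambda>n. inverse (X n) * X n - 1)"
    if X: "padic_cauchy CARD('a) X" "\<not> padic_vanishes CARD('a) X" for X
  proof -
    obtain b N where b: "b > 0" "\<And>n. n \<ge> N \<Longrightarrow> padic_abs CARD('a) (X n) \<ge> b"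
      using padic_cauchy_not_vanishes[OF prime_CARD X] by blast
    have "X n \<noteq> 0" if "n \<ge> N" for n
      using b(2)[OF that] b(1) by (auto simp: padic_abs_0[OF prime_CARD])
    then show ?thesis
      by (intro padic_vanishes_le[OF prime_CARD padic_vanishes_0[OF prime_CARD], of N _ 1])
        (simp add: padic_abs_0[OF prime_CARD])
  qed
  then show "a \<noteq> 0 \<Longrightarrow> inverse a * a = 1"
    by transfer (auto simp: padic_cauchy_inverse[OF prime_CARD])
  show "a div b = a * inverse b" by (rule divide_padic_def)
  show "inverse (0 :: 'a padic) = 0" by transfer simp
qed

end

lift_definition padic_norm :: "'p::prime_card padic \<Rightarrow> real"
  is "\<lambda>X. lim (\<lambda>n. padic_abs CARD('p) (of_phantom X n))"
  by (rule padic_abs_lim_cong[OF prime_CARD]) (simp add: padic_eq_def)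

lemma padic_abs_tendsto_lim:
  fixes X :: "('p::prime_card, nat \<Rightarrow> rat) phantom"
  assumes "padic_eq X X"
  shows "(\<lambda>n. padic_abs CARD('p) (of_phantom X n)) \<longlonglongrightarrow>
    lim (\<lambda>n. padic_abs CARD('p) (of_phantom X n))"
  using assms padic_abs_convergent[OF prime_CARD]
  by (auto simp: padic_eq_def padic_rel_def convergent_LIMSEQ_iff)

lemma padic_norm_nonneg [simp]: "padic_norm (x :: 'p::prime_card padic) \<ge> 0"
  by transfer (rule LIMSEQ_le_const[OF padic_abs_tendsto_lim],
      auto simp: padic_abs_nonneg[OF prime_CARD])

lemma padic_norm_eq_0_iff [simp]: "padic_norm (x :: 'p::prime_card padic) = 0 \<longleftrightarrow> x = 0"
proof (transfer, goal_cases)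
  case (1 X)
  then have "lim (\<lambda>n. padic_abs CARD('p) (of_phantom X n)) = 0 \<longleftrightarrow>
      padic_vanishes CARD('p) (of_phantom X)"
    unfolding padic_vanishes_def using padic_abs_tendsto_lim[OF 1] limI by metis
  then show ?case
    using 1 by (simp add: padic_eq_def padic_rel_def padic_cauchy_const[OF prime_CARD])
qed

lemma padic_norm_mult: "padic_norm (x * y) = padic_norm x * padic_norm (y :: 'p::prime_card padic)"
proof (transfer, goal_cases)
  case (1 X Y)
  then show ?case
    by (auto intro!: limI tendsto_mult padic_abs_tendsto_lim simp: padic_abs_mult[OF prime_CARD])
qed

lemma padic_norm_minus [simp]: "padic_norm (- x) = padic_norm (x :: 'p::prime_card padic)"
  by transfer (simp add: padic_abs_minus[OF prime_CARD])

lemma padic_norm_1 [simp]: "padic_norm (1 :: 'p::prime_card padic) = 1"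
  by transfer (simp add: padic_abs_1[OF prime_CARD])

lemma padic_norm_add_le_max: "padic_norm (x + y) \<le> max (padic_norm x) (padic_norm (y :: 'p::prime_card padic))"
proof (transfer, goal_cases)
  case (1 X Y)
  have "padic_eq (phantom (\<lambda>n. of_phantom X n + of_phantom Y n) :: ('p, nat \<Rightarrow> rat) phantom)
      (phantom (\<lambda>n. of_phantom X n + of_phantom Y n))"
    using 1 by (simp add: padic_eq_def padic_rel_def padic_cauchy_add[OF prime_CARD]
        padic_vanishes_0[OF prime_CARD])
  from padic_abs_tendsto_lim[OF this] show ?case
    by (intro LIMSEQ_le[OF _ tendsto_max[OF padic_abs_tendsto_lim padic_abs_tendsto_lim]])
      (use 1 in \<open>auto intro: padic_abs_add_le_max[OF prime_CARD]\<close>)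
qed

instantiation padic :: (prime_card) metric_space
begin

definition dist_padic :: "'a padic \<Rightarrow> 'a padic \<Rightarrow> real" where
  "dist_padic x y = padic_norm (x - y)"

definition uniformity_padic :: "('a padic \<times> 'a padic) filter" where
  "uniformity_padic = (INF e\<in>{0<..}. principal {(x, y). dist x y < e})"

definition open_padic :: "'a padic set \<Rightarrow> bool" where
  "open_padic U \<longleftrightarrow> (\<forall>x\<in>U. eventually (\<lambda>(x', y). x' = x \<longrightarrow> y \<in> U) uniformity)"

instance
proof
  fix x y z :: "'a padic"
  show "dist x y = 0 \<longleftrightarrow> x = y" by (simp add: dist_padic_def)
  have "padic_norm (x - y) \<le> max (padic_norm (x - z)) (padic_norm (z - y))"
    using padic_norm_add_le_max[of "x - z" "z - y"] by simp
  moreover have "padic_norm (z - y) = padic_norm (y - z)"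
    using padic_norm_minus[of "y - z"] by simp
  moreover note padic_norm_nonneg[of "x - z"] padic_norm_nonneg[of "y - z"]
  ultimately show "dist x y \<le> dist x z + dist y z"
    unfolding dist_padic_def by linarith
qed (simp_all add: uniformity_padic_def open_padic_def)

end

lemma padic_norm_of_nat:
  "padic_norm (of_nat n :: 'p::prime_card padic) = padic_abs CARD('p) (of_nat n)"
proof -
  have eq: "padic_eq (phantom (\<lambda>_. q) :: ('p, _) phantom) (phantom (\<lambda>_. q))" for q
    by (simp add: padic_eq_def padic_rel_refl[OF prime_CARD] padic_cauchy_const[OF prime_CARD])
  have "of_nat n = abs_padic (phantom (\<lambda>_. of_nat n) :: ('p, _) phantom)"
    by (induction n)
      (simp_all add: zero_padic_def one_padic_def plus_padic.abs_eq[OF eq eq])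
  then show ?thesis
    by (simp add: padic_norm.abs_eq[OF eq])
qed

instance padic :: (prime_card) field_char_0
proof
  show "inj (of_nat :: nat \<Rightarrow> 'a padic)"
  proof (rule linorder_injI)
    fix m n :: nat assume "m < n"
    then have "padic_norm (of_nat (n - m) :: 'a padic) \<noteq> 0"
      unfolding padic_norm_of_nat by (simp add: padic_abs_eq_0_iff[OF prime_CARD])
    then show "(of_nat m :: 'a padic) \<noteq> of_nat n"
      using \<open>m < n\<close> by (auto simp: of_nat_diff)
  qed
qed

lemma padic_norm_of_rat: "padic_norm (of_rat q :: 'p::prime_card padic) = padic_abs CARD('p) q"
proof -
  have int: "padic_norm (of_int k :: 'p padic) = padic_abs CARD('p) (of_int k)" for k
    by (cases k) (simp_all add: padic_norm_of_nat padic_abs_minus[OF prime_CARD]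
        del: of_nat_Suc)
  obtain a b where ab: "b > 0" "q = of_int a / of_int b" by (rule rat_fraction_cases[OF prime_CARD])
  have "of_rat q * of_int b = (of_int a :: 'p padic)" "q * of_int b = of_int a"
    using ab by (simp_all add: of_rat_divide)
  then have "padic_norm (of_rat q :: 'p padic) * padic_abs CARD('p) (of_int b) =
      padic_abs CARD('p) q * padic_abs CARD('p) (of_int b)"
    by (metis int padic_norm_mult padic_abs_mult[OF prime_CARD])
  then show ?thesis using ab by (simp add: padic_abs_eq_0_iff[OF prime_CARD])
qed


section \<open>Units of the p-adic integers and local isometries\<close>

definition padic_integers :: "'p::prime_card padic set" where
  "padic_integers = {x. padic_norm x \<le> 1}"

definition padic_integer_units :: "'p::prime_card padic set" where
  "padic_integer_units = {x \<in> padic_integers. \<exists>y\<in>padic_integers. x * y = 1}"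

definition local_isometry :: "('p::prime_card padic \<Rightarrow> 'p padic) \<Rightarrow> bool" where
  "local_isometry f \<longleftrightarrow>
     (\<forall>a. \<exists>r>0. \<forall>x\<in>cball a r. \<forall>y\<in>cball a r. padic_norm (f x - f y) = padic_norm (x - y))"

end

theory Submission
  imports Defs
begin

text \<open>
  Let \<open>W = P\<^sub>1' Q\<^sub>1 - P\<^sub>1 Q\<^sub>1'\<close> be the numerator of the derivative of \<open>P\<^sub>1 / Q\<^sub>1\<close>. A local isometry
  has derivative of absolute value 1, so \<open>\<bar>p\<^sup>\<alpha>\<bar> \<bar>W(x)\<bar> = \<bar>Q\<^sub>1(x)\<bar>\<^sup>2\<close> everywhere. For large \<open>\<bar>x\<bar>\<close> the
  absolute value of a polynomial is that of its leading term, hence \<open>W\<close> has degree \<open>2n\<close> and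
  \<open>\<bar>p\<^sup>\<alpha>\<bar>\<close> times the absolute value of its leading coefficient is 1. If \<open>m \<noteq> n\<close>, the leading term
  of \<open>W\<close> is \<open>(m - n) a\<^sub>m b\<^sub>n x\<^bsup>m + n - 1\<^esup>\<close>; if \<open>m = n\<close>, the degree of \<open>W\<close> is too small.
\<close>

section \<open>The p-adic absolute value\<close>

lemma padic_norm_0 [simp]: "padic_norm (0 :: 'p::prime_card padic) = 0"
  by simp

lemma padic_norm_power: "padic_norm ((x :: 'p::prime_card padic) ^ k) = padic_norm x ^ k"
  by (induction k) (simp_all add: padic_norm_mult)

lemma padic_norm_inverse:
  "padic_norm (inverse x) = inverse (padic_norm (x :: 'p::prime_card padic))"
proof (cases "x = 0")
  case False
  then have "padic_norm x * padic_norm (inverse x) = 1"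
    by (simp flip: padic_norm_mult)
  then show ?thesis
    by (metis inverse_unique)
qed simp

lemma padic_norm_divide:
  "padic_norm (x / y) = padic_norm x / padic_norm (y :: 'p::prime_card padic)"
  by (simp add: divide_inverse padic_norm_mult padic_norm_inverse)

lemma padic_norm_power_int:
  "padic_norm ((x :: 'p::prime_card padic) powi k) = padic_norm x powi k"
  by (simp add: power_int_def padic_norm_power padic_norm_inverse)

lemma padic_norm_diff_commute: "padic_norm (x - y) = padic_norm (y - x :: 'p::prime_card padic)"
  using padic_norm_minus[of "x - y"] by simp

text \<open>The lower bound comes from y = (x + y) - x: as |x| < |y|, the maximum in the ultrametric
  inequality must be |x + y|.\<close>

lemma padic_norm_add_eq_right:
  fixes x y :: "'p::prime_card padic"
  assumes "padic_norm x < padic_norm y"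
  shows "padic_norm (x + y) = padic_norm y"
proof (rule antisym)
  show "padic_norm (x + y) \<le> padic_norm y"
    using padic_norm_add_le_max[of x y] assms by simp
  show "padic_norm y \<le> padic_norm (x + y)"
    using padic_norm_add_le_max[of "x + y" "- x"] assms by simp
qed

lemma padic_norm_diff_le:
  fixes x y :: "'p::prime_card padic"
  shows "\<bar>padic_norm x - padic_norm y\<bar> \<le> padic_norm (x - y)"
proof -
  have "padic_norm u \<le> padic_norm (u - v) + padic_norm v" for u v :: "'p padic"
    using padic_norm_add_le_max[of "u - v" v, unfolded diff_add_cancel]
      padic_norm_nonneg[of "u - v"] padic_norm_nonneg[of v] by linarith
  from this[of x y] this[of y x] show ?thesis
    by (simp add: padic_norm_diff_commute abs_le_iff)
qed

lemma padic_norm_prime: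
  "padic_norm (of_nat CARD('p) :: 'p::prime_card padic) = 1 / real CARD('p)"
proof -
  have p: "prime CARD('p)" by (rule prime_CARD)
  have "padic_abs CARD('p) (of_int (int CARD('p)) / of_int 1) = 1 / real CARD('p)"
    using p by (subst padic_abs_fraction[OF p]) (auto simp: multiplicity_self prime_gt_0_nat)
  then show ?thesis
    by (simp add: padic_norm_of_nat)
qed

lemma padic_integer_units_norm:
  "x \<in> padic_integer_units \<Longrightarrow> padic_norm (x :: 'p::prime_card padic) = 1"
proof -
  assume "x \<in> padic_integer_units"
  then obtain y where y: "padic_norm x \<le> 1" "padic_norm y \<le> 1" "x * y = 1"
    unfolding padic_integer_units_def padic_integers_def by auto
  then have "padic_norm x * padic_norm y = 1"
    by (simp flip: padic_norm_mult)
  then show ?thesis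
    using y mult_left_mono[of "padic_norm y" 1 "padic_norm x"] by simp
qed

section \<open>Polynomials\<close>

lemma padic_poly_bounded:
  fixes P :: "'p::prime_card padic poly"
  shows "\<exists>B. \<forall>x. padic_norm x \<le> M \<longrightarrow> padic_norm (poly P x) \<le> B"
proof (induction P)
  case (pCons c P)
  then obtain B where B: "\<And>x. padic_norm x \<le> M \<Longrightarrow> padic_norm (poly P x) \<le> B" by auto
  have "padic_norm (poly (pCons c P) x) \<le> max (padic_norm c) (M * B)" if "padic_norm x \<le> M" for x
  proof -
    have "padic_norm (x * poly P x) \<le> M * B"
      unfolding padic_norm_mult using that B[OF that]
      by (intro mult_mono) (auto intro: order_trans[OF padic_norm_nonneg])
    then show ?thesis
      using padic_norm_add_le_max[of c "x * poly P x"] by simp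
  qed
  then show ?case by blast
qed auto

text \<open>Continuity of |P| at \<open>a\<close>: P - P(a) is (X - a) T, and T is bounded near
  \<open>a\<close>.\<close>

lemma padic_norm_poly_tendsto:
  fixes P :: "'p::prime_card padic poly"
  assumes "(\<lambda>k. padic_norm (y k - a)) \<longlonglongrightarrow> 0"
  shows "(\<lambda>k. padic_norm (poly P (y k))) \<longlonglongrightarrow> padic_norm (poly P a)"
proof -
  have "poly (P - [:poly P a:]) a = 0" by simp
  then obtain T where T: "P - [:poly P a:] = [:- a, 1:] * T"
    by (metis poly_eq_0_iff_dvd dvdE)
  have diff: "poly P x - poly P a = (x - a) * poly T x" for x
    using arg_cong[OF T, of "\<lambda>q. poly q x"] by (simp add: algebra_simps)
  \<comment> \<open>By the ultrametric inequality this ball contains every \<open>y k\<close> with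
    |y k - a| < 1.\<close>
  obtain B where B: "\<And>x. padic_norm x \<le> max 1 (padic_norm a) \<Longrightarrow> padic_norm (poly T x) \<le> B"
    using padic_poly_bounded by blast
  have "\<forall>\<^sub>F k in sequentially. padic_norm (y k - a) < 1"
    using assms by (rule order_tendstoD) simp
  then have "\<forall>\<^sub>F k in sequentially.
      norm (padic_norm (poly P (y k)) - padic_norm (poly P a)) \<le>
      norm (padic_norm (y k - a)) * B"
  proof eventually_elim
    case (elim k)
    have "padic_norm (y k) \<le> max 1 (padic_norm a)"
      using padic_norm_add_le_max[of "y k - a" a] elim by auto
    then show ?case
      using padic_norm_diff_le[of "poly P (y k)" "poly P a"] B[of "y k"]
        mult_left_mono[of "padic_norm (poly T (y k))" B "padic_norm (y k - a)"]
      by (simp add: diff padic_norm_mult)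
  qed
  then show ?thesis
    by (rule LIM_zero_cancel[OF tendsto_0_le[OF assms]])
qed

text \<open>Horner induction: far out, x P(x) strictly dominates the constant \<open>c\<close>, so
  the ultrametric inequality becomes an equality.\<close>

lemma padic_norm_poly_at_infinity:
  fixes P :: "'p::prime_card padic poly"
  assumes "P \<noteq> 0"
  shows "\<exists>R. \<forall>x. padic_norm x > R \<longrightarrow>
    padic_norm (poly P x) = padic_norm (lead_coeff P) * padic_norm x ^ degree P"
  using assms
proof (induction P)
  case (pCons c P)
  show ?case
  proof (cases "P = 0")
    case False
    then obtain R where R: "\<And>x. padic_norm x > R \<Longrightarrow>
        padic_norm (poly P x) = padic_norm (lead_coeff P) * padic_norm x ^ degree P"
      using pCons by auto
    define l where "l = padic_norm (lead_coeff P)"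
    have l: "l > 0"
      using False padic_norm_nonneg[of "lead_coeff P"]
      by (simp add: l_def order_less_le del: padic_norm_nonneg)
    \<comment> \<open>Beyond \<open>R\<close> the induction hypothesis applies, beyond |c| / l one
      has |c| < l |x|, and |x| > 1 gives |x| \<le> |x|^(deg P + 1).\<close>
    have "padic_norm (poly (pCons c P) x) =
        padic_norm (lead_coeff (pCons c P)) * padic_norm x ^ degree (pCons c P)"
      if x: "padic_norm x > max R (max 1 (padic_norm c / l))" for x
    proof -
      have eq: "padic_norm (x * poly P x) = l * padic_norm x ^ Suc (degree P)"
        using R x by (simp add: padic_norm_mult l_def)
      have "padic_norm c < l * padic_norm x"
        using x l by (simp add: pos_divide_less_eq mult.commute)
      also have "\<dots> \<le> l * padic_norm x ^ Suc (degree P)"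
        using x l self_le_power[of "padic_norm x" "Suc (degree P)"] by simp
      finally have "padic_norm (c + x * poly P x) = l * padic_norm x ^ Suc (degree P)"
        using eq padic_norm_add_eq_right[of c "x * poly P x"] by simp
      then show ?thesis using False by (simp add: l_def)
    qed
    then show ?thesis by blast
  qed (simp add: padic_norm_mult)
qed simp

text \<open>Indexing by position instead of leading term lets P' Q and Q' P be subtracted at one
  common index.\<close>

lemma coeff_pderiv_mult_top:
  fixes P Q :: "'a::{comm_semiring_1,semiring_no_zero_divisors,semiring_char_0} poly"
  assumes "degree P + degree Q > 0"
  shows "coeff (pderiv P * Q) (degree P + degree Q - 1) =
    of_nat (degree P) * lead_coeff P * lead_coeff Q"
proof (cases "degree P")
  case 0
  then show ?thesis by (metis mult_zero_left of_nat_0 coeff_0 pderiv_eq_0_iff)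
next
  case (Suc d)
  then have "degree (pderiv P) = d" by (simp add: degree_pderiv)
  then have "coeff (pderiv P * Q) (d + degree Q) = coeff (pderiv P) d * lead_coeff Q"
    using coeff_mult_degree_sum by metis
  then show ?thesis using Suc by (simp add: coeff_pderiv)
qed

lemma degree_pderiv_mult_le:
  fixes P Q :: "'a::{comm_semiring_1,semiring_no_zero_divisors,semiring_char_0} poly"
  shows "degree (pderiv P * Q) \<le> degree P + degree Q - 1"
proof (cases "degree P")
  case 0
  then have "pderiv P = 0" by (simp add: pderiv_eq_0_iff)
  then show ?thesis by simp
next
  case (Suc d)
  then show ?thesis using degree_mult_le[of "pderiv P" Q] by (simp add: degree_pderiv)
qed

section \<open>Rational local isometries\<close>

text \<open>No derivative of \<open>f\<close> is formed: the factor x - a is split off from f(x) -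
  f(a) algebraically, its absolute value is cancelled by the isometry property, and then x tends to
  \<open>a\<close>.\<close>

lemma local_isometry_rational_wronskian:
  fixes P Q :: "'p::prime_card padic poly"
  assumes Q: "\<And>x. poly Q x \<noteq> 0" and f: "\<And>x. f x = c * (poly P x / poly Q x)"
    and "local_isometry f"
  shows "padic_norm c * padic_norm (poly (pderiv P * Q - pderiv Q * P) a) = padic_norm (poly Q a) ^ 2"
proof -
  \<comment> \<open>The numerator of P/Q - P(a)/Q(a) over the denominator Q(a) Q.\<close>
  define R where "R = smult (poly Q a) P - smult (poly P a) Q"
  have "poly R a = 0" by (simp add: R_def)
  then obtain S where S: "R = [:- a, 1:] * S"
    by (metis poly_eq_0_iff_dvd dvdE)
  \<comment> \<open>Both sides are R'(a): once by the product rule for (X - a) S, once from the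
    definition of \<open>R\<close>.\<close>
  have Sa: "poly S a = poly (pderiv P * Q - pderiv Q * P) a"
  proof -
    have "poly (pderiv R) a = poly S a"
      unfolding S pderiv_mult by (simp add: pderiv_pCons)
    moreover have "poly (pderiv R) a = poly (pderiv P * Q - pderiv Q * P) a"
      by (simp add: R_def pderiv_diff pderiv_smult algebra_simps)
    ultimately show ?thesis by simp
  qed
  have diff: "f x - f a = c * ((x - a) * poly S x / (poly Q a * poly Q x))" for x
  proof -
    have eq: "(x - a) * poly S x = poly P x * poly Q a - poly P a * poly Q x"
      using arg_cong[OF S, of "\<lambda>q. poly q x"] by (simp add: R_def algebra_simps)
    show ?thesis
      unfolding eq f using Q[of a] Q[of x] by (simp add: field_simps)
  qed
  obtain r where r: "r > 0"
    "\<And>x y. x \<in> cball a r \<Longrightarrow> y \<in> cball a r \<Longrightarrow> padic_norm (f x - f y) = padic_norm (x - y)"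
    using assms(3) unfolding local_isometry_def by blast
  \<comment> \<open>These points tend to \<open>a\<close> without ever equalling it, so |y k - a|
    can be cancelled.\<close>
  define y where "y k = a + of_nat CARD('p) ^ k" for k
  have p: "CARD('p) > 1" using prime_CARD prime_gt_1_nat by blast
  have y: "padic_norm (y k - a) = (1 / real CARD('p)) ^ k" for k
    by (simp add: y_def padic_norm_power padic_norm_prime)
  have lim: "(\<lambda>k. padic_norm (y k - a)) \<longlonglongrightarrow> 0"
    unfolding y using p by (intro LIMSEQ_realpow_zero) auto
  have "\<forall>\<^sub>F k in sequentially. padic_norm (y k - a) < r"
    using lim r(1) by (rule order_tendstoD)
  then have "\<forall>\<^sub>F k in sequentially. padic_norm c * padic_norm (poly S (y k)) =
      padic_norm (poly Q a) * padic_norm (poly Q (y k))"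
  proof eventually_elim
    case (elim k)
    have pos: "padic_norm (y k - a) > 0" using p by (simp add: y)
    have "padic_norm (f (y k) - f a) = padic_norm (y k - a)"
      using elim r by (simp add: dist_padic_def padic_norm_diff_commute)
    then show ?case
      using pos Q[of a] Q[of "y k"]
      unfolding diff padic_norm_mult padic_norm_divide by (auto simp: field_simps)
  qed
  then have "(\<lambda>k. padic_norm c * padic_norm (poly S (y k))) \<longlonglongrightarrow>
      padic_norm (poly Q a) * padic_norm (poly Q a)"
    using tendsto_mult_left[OF padic_norm_poly_tendsto[OF lim]] by (simp add: filterlim_cong)
  moreover have "(\<lambda>k. padic_norm c * padic_norm (poly S (y k))) \<longlonglongrightarrow>
      padic_norm c * padic_norm (poly S a)"
    by (intro tendsto_mult_left padic_norm_poly_tendsto lim)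
  ultimately show ?thesis
    using LIMSEQ_unique unfolding Sa power2_eq_square by metis
qed

text \<open>The powers p^(-k) serve as points near infinity whose absolute value is exactly
  p^k.\<close>

lemma padic_norm_unbounded:
  obtains k0 where "\<And>k. k \<ge> k0 \<Longrightarrow> padic_norm (inverse (of_nat CARD('p) ^ k) :: 'p::prime_card padic) > M"
proof -
  have p: "real CARD('p) > 1" using prime_CARD prime_gt_1_nat by (metis of_nat_1 of_nat_less_iff)
  obtain k0 where "M < real CARD('p) ^ k0" using real_arch_pow[OF p] by blast
  then have "M < real CARD('p) ^ k" if "k \<ge> k0" for k
    using power_increasing[OF that, of "real CARD('p)"] p by linarith
  then show ?thesis
    by (intro that[of k0])
      (simp add: padic_norm_inverse padic_norm_power padic_norm_prime power_one_over)
qed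

text \<open>Dividing the equation at \<open>k0 + 1\<close> by the one at \<open>k0\<close> leaves
  q^d = q^e.\<close>

lemma monomial_eq_at_powers:
  fixes q A :: real
  assumes q: "q > 1" and eq: "\<And>k. k \<ge> k0 \<Longrightarrow> A * (q ^ k) ^ d = (q ^ k) ^ e"
  shows "d = e" and "A = 1"
proof -
  have "A * (q ^ k0) ^ d * q ^ d = (q ^ k0) ^ e * q ^ e"
    using eq[of "Suc k0"] by (simp add: power_mult_distrib mult_ac)
  then have "q ^ d = q ^ e" using eq[of k0] q by simp
  then show "d = e" using q by (simp add: power_inject_exp)
  then show "A = 1" using eq[of k0] q by simp
qed

theorem proposition5p1:
  fixes f :: "'p::prime_card padic \<Rightarrow> 'p padic"
    and P\<^sub>1 Q\<^sub>1 :: "'p padic poly"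
    and \<alpha> :: int
    and m n :: nat
  assumes "degree P\<^sub>1 = m" and "coeff P\<^sub>1 m \<in> padic_integer_units"
    and "degree Q\<^sub>1 = n" and "coeff Q\<^sub>1 n \<in> padic_integer_units"
    and "\<And>x. poly Q\<^sub>1 x \<noteq> 0"
    and "\<And>x. f x = of_nat CARD('p) powi \<alpha> * (poly P\<^sub>1 x / poly Q\<^sub>1 x)"
    and "local_isometry f" and "bij f"
  shows "\<alpha> = 0 \<and> m = n + 1"
proof -
  define q where "q = real CARD('p)"
  have q: "q > 1"
    unfolding q_def using prime_CARD prime_gt_1_nat by (metis of_nat_1 of_nat_less_iff)
  define A where "A = padic_norm (of_nat CARD('p) powi \<alpha> :: 'p padic)"
  define W where "W = pderiv P\<^sub>1 * Q\<^sub>1 - pderiv Q\<^sub>1 * P\<^sub>1"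
  have W: "A * padic_norm (poly W x) = padic_norm (poly Q\<^sub>1 x) ^ 2" for x
    unfolding A_def W_def by (rule local_isometry_rational_wronskian[OF assms(5,6,7)])
  have nP: "padic_norm (lead_coeff P\<^sub>1) = 1" and nQ: "padic_norm (lead_coeff Q\<^sub>1) = 1"
    using assms(1-4) padic_integer_units_norm by auto
  \<comment> \<open>The identity \<open>W\<close> at 0 has a nonzero right side, so neither
    polynomial vanishes there.\<close>
  have Q0: "Q\<^sub>1 \<noteq> 0" and W0: "W \<noteq> 0"
    using assms(5)[of 0] W[of 0] by auto
  obtain R where R: "\<And>x. padic_norm x > R \<Longrightarrow>
      padic_norm (poly W x) = padic_norm (lead_coeff W) * padic_norm x ^ degree W"
    using padic_norm_poly_at_infinity[OF W0] by blast
  obtain R' where R': "\<And>x. padic_norm x > R' \<Longrightarrow>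
      padic_norm (poly Q\<^sub>1 x) = padic_norm (lead_coeff Q\<^sub>1) * padic_norm x ^ degree Q\<^sub>1"
    using padic_norm_poly_at_infinity[OF Q0] by blast
  obtain k0 where k0: "\<And>k. k \<ge> k0 \<Longrightarrow>
      padic_norm (inverse (of_nat CARD('p) ^ k) :: 'p padic) > max R R'"
    using padic_norm_unbounded by blast
  have eq: "A * padic_norm (lead_coeff W) * (q ^ k) ^ degree W = (q ^ k) ^ (2 * n)" if "k \<ge> k0" for k
  proof -
    define x :: "'p padic" where "x = inverse (of_nat CARD('p) ^ k)"
    have "padic_norm x = q ^ k"
      by (simp add: x_def q_def padic_norm_inverse padic_norm_power padic_norm_prime power_one_over)
    moreover have "padic_norm x > R" "padic_norm x > R'"
      using k0[OF that] by (simp_all add: x_def)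
    ultimately show ?thesis
      using W[of x] R[of x] R'[of x] nQ assms(3)
      by (simp add: mult.commute[of 2] mult.assoc flip: power_mult)
  qed
  have degW: "degree W = 2 * n" and lcW: "A * padic_norm (lead_coeff W) = 1"
    using monomial_eq_at_powers[OF q eq] by blast+
  \<comment> \<open>This makes m + n - 1 a true difference; truncated at m = n = 0, the degree bound
    below would not force n < m.\<close>
  have mn: "m + n > 0"
  proof (rule ccontr)
    assume "\<not> m + n > 0"
    then have "pderiv P\<^sub>1 = 0" "pderiv Q\<^sub>1 = 0"
      using assms(1,3) by (simp_all add: pderiv_eq_0_iff)
    then show False using W0 by (simp add: W_def)
  qed
  \<comment> \<open>Now 2n \<le> m + n - 1, which excludes m = n and m < n together.\<close>
  have "degree W \<le> m + n - 1"
    unfolding W_def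
    using degree_pderiv_mult_le[of P\<^sub>1 Q\<^sub>1] degree_pderiv_mult_le[of Q\<^sub>1 P\<^sub>1] assms(1,3)
    by (intro degree_diff_le) (simp_all add: add.commute)
  then have less: "n < m" using degW mn by linarith
  have top: "coeff W (m + n - 1) = of_nat (m - n) * lead_coeff P\<^sub>1 * lead_coeff Q\<^sub>1"
    using coeff_pderiv_mult_top[of P\<^sub>1 Q\<^sub>1] coeff_pderiv_mult_top[of Q\<^sub>1 P\<^sub>1] mn less assms(1,3)
    by (simp add: W_def add.commute of_nat_diff algebra_simps)
  \<comment> \<open>The integer m - n may still be divisible by p here; characteristic 0 suffices to
    make it nonzero.\<close>
  have "coeff W (m + n - 1) \<noteq> 0"
    unfolding top using less nP nQ by auto
  then have "m + n - 1 \<le> 2 * n"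
    using le_degree degW by metis
  then have m: "m = n + 1" using less by linarith
  \<comment> \<open>With m = n + 1 the factor m - n is 1, so the leading coefficient of
    \<open>W\<close> has absolute value 1.\<close>
  have "lead_coeff W = lead_coeff P\<^sub>1 * lead_coeff Q\<^sub>1"
    using top unfolding degW m by (simp add: mult_2)
  then have "A = 1"
    using lcW nP nQ by (simp add: padic_norm_mult)
  \<comment> \<open>\<open>A\<close> is (1/q)^\<alpha>, the inverse of q^\<alpha>.\<close>
  then have "q powi \<alpha> = 1"
    unfolding A_def padic_norm_power_int padic_norm_prime q_def
    by (simp add: power_int_divide_distrib)
  then have "\<alpha> = 0"
    using q power_int_strict_increasing[of \<alpha> 0 q] power_int_strict_increasing[of 0 \<alpha> q]
    by (cases \<alpha> "0 :: int" rule: linorder_cases) auto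
  with m show ?thesis by simp
qed

end
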